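(* Let $N,p\ge1$ be integers, $\lambda>0$, $X_1,\dots,X_N\in L^2(\mathbb I)$ and $Y_1,\dots,Y_N\in\mathbb R$, and let $c_{i,s}=\int_{\mathbb I}X_i(\tau)X_s(\tau)\,d\mu(\tau)$. Suppose real numbers $b_0$ and $b_{k,i}$ ($k=1,\dots,p$, $i=1,\dots,N$) solve the linear system $$(\lambda+1)b_0+\frac1N\sum_{i=1}^N\sum_{l=1}^p\sum_{s=1}^Nb_{l,s}\,c_{i,s}^{\,l}=\frac1N\sum_{i=1}^NY_i,$$ $$\lambda b_{k,i}+\frac1Nb_0+\frac1N\sum_{l=1}^p\sum_{s=1}^Nb_{l,s}\,c_{i,s}^{\,l}=\frac1NY_i,\qquad k=1,\dots,p,\ i=1,\dots,N,$$ where $c_{i,s}^{\,l}$ denotes the $l$-th power of $c_{i,s}$. Then the element $u=(u_0,\dots,u_p)\in\mathbb L^2$ with $u_0=b_0$ and $u_l(s_1,\dots,s_l)=\sum_{i=1}^Nb_{l,i}\prod_{j=1}^lX_i(s_j)$, $l=1,\dots,p$, solves the empirical Tikhonov equation $\lambda u+[\mathbb A^*\mathbb A]_Nu=[\mathbb A^*Y]_N$; moreover $$b_{k,i}=b_{1,i}\quad\text{for all }k=1,\dots,p,\ i=1,\dots,N,\qquad\text{and}\qquad b_0=\sum_{i=1}^Nb_{k,i}\quad\text{for all }k=1,\dots,p,$$ so the coefficients of Tikhonov-regularized polynomial functional regression are completely determined by those of its linear term.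
   Context: $\mathbb I\subset\mathbb R^d$ is measurable with Lebesgue measure $\mu$; $L^2_0=\mathbb R$, $L^2_l=L^2(\mathbb I^l)$ for $l\ge1$, and $\mathbb L^2=\bigoplus_{l=0}^pL^2_l$ with the direct-sum Hilbert norm. For each $i$ put $\mathcal X^i=(1,\mathcal X^i_1,\dots,\mathcal X^i_p)\in\mathbb L^2$ with $\mathcal X^i_l(s_1,\dots,s_l)=\prod_{j=1}^lX_i(s_j)$. Then $[\mathbb A^*\mathbb A]_N:\mathbb L^2\to\mathbb L^2$ is $[\mathbb A^*\mathbb A]_Nu=\frac1N\sum_{i=1}^N\mathcal X^i\langle\mathcal X^i,u\rangle_{\mathbb L^2}$, and $[\mathbb A^*Y]_N=\frac1N\sum_{i=1}^NY_i\mathcal X^i\in\mathbb L^2$. *)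

theory Defs
  imports "HOL-Analysis.Analysis"
begin

text \<open>
  The measure space \<open>I^l\<close> with its Lebesgue measure.  A point \<open>(s_1, \<dots>, s_l)\<close> is a function \<open>s\<close>
  in the extensional product of \<open>l\<close> copies of \<open>I\<close>, indexed by \<open>{1..l}\<close>.  The completion makes the
  measurable functions the Lebesgue measurable ones, as \<open>PiM\<close> alone is not complete.
\<close>

definition cube_measure :: "(real ^ 'd) set \<Rightarrow> nat \<Rightarrow> (nat \<Rightarrow> real ^ 'd) measure" where
  "cube_measure I l = completion (PiM {1..l} (\<lambda>_. lebesgue_on I))"

text \<open>
  Elements of \<open>L\<^sup>2\<close> spaces are given by representatives, so that equality in \<open>L\<^sup>2\<close> is equality almost
  everywhere.
\<close>

definition L2 :: "'a measure \<Rightarrow> ('a \<Rightarrow> real) set" where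
  "L2 M = {f. f \<in> borel_measurable M \<and> integrable M (\<lambda>x. (f x)\<^sup>2)}"

text \<open>
  An element \<open>(u_0, u_1, \<dots>, u_p)\<close> of the direct sum is the pair of the number \<open>u_0\<close> and the family
  \<open>l \<mapsto> u_l\<close>, of which only the members with \<open>1 \<le> l \<le> p\<close> are relevant.
\<close>

type_synonym 'd dsum = "real \<times> (nat \<Rightarrow> (nat \<Rightarrow> real ^ 'd) \<Rightarrow> real)"

definition dsum_L2 :: "(real ^ 'd) set \<Rightarrow> nat \<Rightarrow> 'd dsum set" where
  "dsum_L2 I p = {u. \<forall>l\<in>{1..p}. snd u l \<in> L2 (cube_measure I l)}"

definition dsum_eq :: "(real ^ 'd) set \<Rightarrow> nat \<Rightarrow> 'd dsum \<Rightarrow> 'd dsum \<Rightarrow> bool" where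
  "dsum_eq I p u v \<longleftrightarrow>
     fst u = fst v \<and> (\<forall>l\<in>{1..p}. AE s in cube_measure I l. snd u l s = snd v l s)"

definition dsum_inner :: "(real ^ 'd) set \<Rightarrow> nat \<Rightarrow> 'd dsum \<Rightarrow> 'd dsum \<Rightarrow> real" where
  "dsum_inner I p u v =
     fst u * fst v + (\<Sum>l=1..p. LINT s|cube_measure I l. snd u l s * snd v l s)"

definition dsum_add :: "'d dsum \<Rightarrow> 'd dsum \<Rightarrow> 'd dsum" where
  "dsum_add u v = (fst u + fst v, \<lambda>l s. snd u l s + snd v l s)"

definition dsum_scale :: "real \<Rightarrow> 'd dsum \<Rightarrow> 'd dsum" where
  "dsum_scale a u = (a * fst u, \<lambda>l s. a * snd u l s)"

definition dsum_sum :: "nat \<Rightarrow> (nat \<Rightarrow> 'd dsum) \<Rightarrow> 'd dsum" where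
  "dsum_sum N v = (\<Sum>i=1..N. fst (v i), \<lambda>l s. \<Sum>i=1..N. snd (v i) l s)"

definition poly_feature :: "(real ^ 'd \<Rightarrow> real) \<Rightarrow> 'd dsum" where
  "poly_feature x = (1, \<lambda>l s. \<Prod>j=1..l. x (s j))"

text \<open>The empirical operator \<open>[A\<^sup>*A]\<^sub>N\<close> and the empirical right-hand side \<open>[A\<^sup>*Y]\<^sub>N\<close>.\<close>

definition emp_AA ::
  "(real ^ 'd) set \<Rightarrow> nat \<Rightarrow> nat \<Rightarrow> (nat \<Rightarrow> real ^ 'd \<Rightarrow> real) \<Rightarrow> 'd dsum \<Rightarrow> 'd dsum" where
  "emp_AA I p N X u =
     dsum_scale (1 / real N)
       (dsum_sum N (\<lambda>i. dsum_scale (dsum_inner I p (poly_feature (X i)) u) (poly_feature (X i))))"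

definition emp_AY ::
  "nat \<Rightarrow> (nat \<Rightarrow> real ^ 'd \<Rightarrow> real) \<Rightarrow> (nat \<Rightarrow> real) \<Rightarrow> 'd dsum" where
  "emp_AY N X Y =
     dsum_scale (1 / real N) (dsum_sum N (\<lambda>i. dsum_scale (Y i) (poly_feature (X i))))"

end

(*
  Subtracting the equations for (k, i) and (1, i) gives b k i = b 1 i, and summing the equations for
  fixed k over i and comparing with the first equation gives lam * b0 = lam * (SUM i. b k i).
  For the Tikhonov equation, Fubini turns the inner product of two tensor powers x^l and y^l into
  <x, y>^l, so <X^i, u> = b0 + (SUM l s. b l s * c i s ^ l); in degree l the equation is then the
  linear combination of the equations for (l, i) with weights X^i_l, pointwise.
*)
theory Submission
  imports Defs
begin

lemma L2_mult_integrable: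
  assumes "f \<in> L2 M" "g \<in> L2 M"
  shows "integrable M (\<lambda>x. f x * g x)"
proof (rule Bochner_Integration.integrable_bound)
  show "integrable M (\<lambda>x. (f x)\<^sup>2 + (g x)\<^sup>2)"
    using assms by (auto simp: L2_def)
  show "(\<lambda>x. f x * g x) \<in> borel_measurable M"
    using assms by (auto simp: L2_def)
  \<comment> \<open>The AM-GM bound without its factor 1/2 is enough for domination; dropping the
    factor uses that \<bar>y\<bar> * \<bar>z\<bar> is nonnegative.\<close>
  have "\<bar>y * z\<bar> \<le> y\<^sup>2 + z\<^sup>2" for y z :: real
  proof -
    have "2 * (\<bar>y\<bar> * \<bar>z\<bar>) \<le> y\<^sup>2 + z\<^sup>2"
      using sum_squares_bound[of "\<bar>y\<bar>" "\<bar>z\<bar>"] by (simp add: mult.assoc)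
    moreover have "0 \<le> \<bar>y\<bar> * \<bar>z\<bar>"
      by simp
    ultimately show ?thesis
      unfolding abs_mult by linarith
  qed
  then show "AE x in M. norm (f x * g x) \<le> norm ((f x)\<^sup>2 + (g x)\<^sup>2)"
    by simp
qed

lemma L2_cmult:
  assumes "f \<in> L2 M"
  shows "(\<lambda>x. a * f x) \<in> L2 M"
  using assms by (auto simp: L2_def power_mult_distrib)

lemma L2_add:
  assumes "f \<in> L2 M" "g \<in> L2 M"
  shows "(\<lambda>x. f x + g x) \<in> L2 M"
proof -
  have "integrable M (\<lambda>x. (f x)\<^sup>2 + (g x)\<^sup>2 + 2 * (f x * g x))"
    using assms L2_mult_integrable[OF assms]
    by (intro Bochner_Integration.integrable_add integrable_mult_right) (auto simp: L2_def)
  then show ?thesis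
    using assms by (auto simp: L2_def power2_sum mult.assoc)
qed

lemma L2_sum:
  assumes "\<And>i. i \<in> A \<Longrightarrow> f i \<in> L2 M"
  shows "(\<lambda>x. \<Sum>i\<in>A. f i x) \<in> L2 M"
  using assms
proof (induction A rule: infinite_finite_induct)
  case (insert i A)
  then show ?case
    using L2_add[of "f i" M "\<lambda>x. \<Sum>i\<in>A. f i x"] by simp
\<comment> \<open>For infinite or empty \<open>A\<close> the sum is the zero function.\<close>
qed (simp_all add: L2_def)

text \<open>A countable cover by sets of finite measure survives completion, which keeps these sets
  and their measures. This is for \<open>lebesgue\<close>, the completion of \<open>lborel\<close>:
  Fubini on the cube wants sigma-finite factors.\<close>

lemma sigma_finite_completion:
  assumes "sigma_finite_measure M"
  shows "sigma_finite_measure (completion M)"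
proof -
  from sigma_finite_measure.sigma_finite_countable[OF assms]
  obtain A where "countable A" "A \<subseteq> sets M" "\<Union>A = space M" "\<forall>a\<in>A. emeasure M a \<noteq> \<infinity>"
    by blast
  then show ?thesis
    by (intro sigma_finite_measure.intro exI[of _ A]) (auto simp: subset_iff)
qed

lemma sigma_finite_lebesgue_on:
  fixes I :: "'a :: euclidean_space set"
  assumes "I \<in> sets lebesgue"
  shows "sigma_finite_measure (lebesgue_on I)"
  using assms
  by (intro sigma_finite_measure_restrict_space sigma_finite_completion sigma_finite_lborel)

context
  fixes I :: "(real ^ 'd) set"
  assumes I: "I \<in> sets lebesgue"
begin

interpretation product_sigma_finite "\<lambda>_ :: nat. lebesgue_on I"
  using sigma_finite_lebesgue_on[OF I] by (simp add: product_sigma_finite_def)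

text \<open>Measurability is with respect to the product before completion: only for such functions
  do integrability and integrals carry over between \<open>PiM\<close> and its completion.\<close>

lemma cube_measure_prod_measurable:
  assumes "f \<in> borel_measurable (lebesgue_on I)"
  shows "(\<lambda>s. \<Prod>j=1..l. f (s j) :: real) \<in> borel_measurable (PiM {1..l} (\<lambda>_. lebesgue_on I))"
  using assms by measurable

lemma cube_measure_prod_integrable:
  assumes "integrable (lebesgue_on I) f"
  shows "integrable (cube_measure I l) (\<lambda>s. \<Prod>j=1..l. f (s j) :: real)"
  unfolding cube_measure_def
  using assms cube_measure_prod_measurable[of f l] product_integrable_prod[of "{1..l}" "\<lambda>_. f"]
  by (simp add: integrable_completion)

lemma cube_measure_prod_integral:
  assumes "integrable (lebesgue_on I) f"
  shows "(LINT s|cube_measure I l. (\<Prod>j=1..l. f (s j) :: real)) = (LINT t|lebesgue_on I. f t) ^ l"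
  unfolding cube_measure_def
  using assms cube_measure_prod_measurable[of f l] product_integral_prod[of "{1..l}" "\<lambda>_. f"]
  by (simp add: integral_completion)

text \<open>The square of a tensor power is the tensor power of the square, so Fubini for
  \<open>(x t)\<^sup>2\<close> applies.\<close>

lemma tensor_power_in_L2:
  assumes "x \<in> L2 (lebesgue_on I)"
  shows "(\<lambda>s. \<Prod>j=1..l. x (s j)) \<in> L2 (cube_measure I l)"
  using assms cube_measure_prod_measurable[of x l]
    cube_measure_prod_integrable[of "\<lambda>t. (x t)\<^sup>2" l]
  by (auto simp: L2_def cube_measure_def prod_power_distrib intro: measurable_completion)

end

theorem mainTheorem2:
  fixes I :: "(real ^ 'd) set"
    and N p :: nat
    and lam :: real
    and X :: "nat \<Rightarrow> real ^ 'd \<Rightarrow> real"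
    and Y :: "nat \<Rightarrow> real"
    and c :: "nat \<Rightarrow> nat \<Rightarrow> real"
    and b0 :: real
    and b :: "nat \<Rightarrow> nat \<Rightarrow> real"
    and u :: "'d dsum"
  assumes "I \<in> sets lebesgue"
    and "N \<ge> 1" and "p \<ge> 1" and "lam > 0"
    and "\<And>i. i \<in> {1..N} \<Longrightarrow> X i \<in> L2 (lebesgue_on I)"
    and "\<And>i s. i \<in> {1..N} \<Longrightarrow> s \<in> {1..N} \<Longrightarrow>
           c i s = (LINT \<tau>|lebesgue_on I. X i \<tau> * X s \<tau>)"
    and "(lam + 1) * b0 + 1 / real N * (\<Sum>i=1..N. \<Sum>l=1..p. \<Sum>s=1..N. b l s * c i s ^ l)
           = 1 / real N * (\<Sum>i=1..N. Y i)"
    and "\<And>k i. k \<in> {1..p} \<Longrightarrow> i \<in> {1..N} \<Longrightarrow>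
           lam * b k i + 1 / real N * b0 + 1 / real N * (\<Sum>l=1..p. \<Sum>s=1..N. b l s * c i s ^ l)
             = 1 / real N * Y i"
    and "u = (b0, \<lambda>l s. \<Sum>i=1..N. b l i * (\<Prod>j=1..l. X i (s j)))"
  shows "u \<in> dsum_L2 I p
    \<and> dsum_eq I p (dsum_add (dsum_scale lam u) (emp_AA I p N X u)) (emp_AY N X Y)
    \<and> (\<forall>k\<in>{1..p}. \<forall>i\<in>{1..N}. b k i = b 1 i)
    \<and> (\<forall>k\<in>{1..p}. b0 = (\<Sum>i=1..N. b k i))"
proof -
  note I = assms(1) and X = assms(5) and c = assms(6) and eq0 = assms(7) and eqk = assms(8)
    and u = assms(9)
  define S where "S i = (\<Sum>l=1..p. \<Sum>s=1..N. b l s * c i s ^ l)" for i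
  have in_L2: "u \<in> dsum_L2 I p"
    using tensor_power_in_L2[OF I X]
    by (auto simp: dsum_L2_def u intro!: L2_sum L2_cmult)
  have same: "b k i = b 1 i" if "k \<in> {1..p}" "i \<in> {1..N}" for k i
  proof -
    have one: "1 \<in> {1..p}"
      using assms(3) by simp
    have "lam * b k i = lam * b 1 i"
      using eqk[OF that] eqk[OF one that(2)] by linarith
    then show ?thesis
      using assms(4) by simp
  qed
  have total: "b0 = (\<Sum>i=1..N. b k i)" if k: "k \<in> {1..p}" for k
  proof -
    have "(\<Sum>i=1..N. lam * b k i + 1 / real N * b0 + 1 / real N * S i) = (\<Sum>i=1..N. 1 / real N * Y i)"
      unfolding S_def using eqk[OF k] by (intro sum.cong) auto
    then have "lam * (\<Sum>i=1..N. b k i) + b0 + 1 / real N * (\<Sum>i=1..N. S i)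
        = 1 / real N * (\<Sum>i=1..N. Y i)"
      using assms(2) by (simp add: sum.distrib sum_distrib_left sum_divide_distrib)
    \<comment> \<open>With \<open>(lam + 1) * b0\<close> split, the first equation shares with the
      summed one the term \<open>b0\<close>, the sum of the \<open>S i\<close> and the right-hand
      side.\<close>
    then have "lam * b0 = lam * (\<Sum>i=1..N. b k i)"
      using eq0 unfolding S_def[symmetric] distrib_right by linarith
    then show ?thesis
      using assms(4) by simp
  qed
  have inner: "dsum_inner I p (poly_feature (X i)) u = b0 + S i" if i: "i \<in> {1..N}" for i
  proof -
    have "(LINT s|cube_measure I l. (\<Prod>j=1..l. X i (s j)) * (\<Sum>r=1..N. b l r * (\<Prod>j=1..l. X r (s j))))
        = (\<Sum>r=1..N. b l r * c i r ^ l)" for l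
    proof -
      have int: "integrable (lebesgue_on I) (\<lambda>t. X i t * X r t)" if "r \<in> {1..N}" for r
        using X[OF i] X[OF that] by (rule L2_mult_integrable)
      \<comment> \<open>Two tensor powers multiply to the tensor power of
        \<open>X i t * X r t\<close>, whose integral over the cube is the \<open>l\<close>-th power
        of \<open>c i r\<close>.\<close>
      have "(LINT s|cube_measure I l. (\<Prod>j=1..l. X i (s j)) * (\<Sum>r=1..N. b l r * (\<Prod>j=1..l. X r (s j))))
          = (LINT s|cube_measure I l. (\<Sum>r=1..N. b l r * (\<Prod>j=1..l. X i (s j) * X r (s j))))"
        by (simp add: sum_distrib_left prod.distrib mult.left_commute)
      also have "\<dots> = (\<Sum>r=1..N. LINT s|cube_measure I l. b l r * (\<Prod>j=1..l. X i (s j) * X r (s j)))"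
        using cube_measure_prod_integrable[OF I int]
        by (intro Bochner_Integration.integral_sum integrable_mult_right)
      also have "\<dots> = (\<Sum>r=1..N. b l r * c i r ^ l)"
        using cube_measure_prod_integral[OF I int] c[OF i] by (intro sum.cong) simp_all
      finally show ?thesis .
    qed
    then show ?thesis
      by (simp add: dsum_inner_def poly_feature_def u S_def)
  qed
  have AA: "emp_AA I p N X u = (1 / real N * (\<Sum>i=1..N. b0 + S i),
      \<lambda>l s. 1 / real N * (\<Sum>i=1..N. (b0 + S i) * (\<Prod>j=1..l. X i (s j))))"
    \<comment> \<open>\<open>poly_feature\<close> stays folded until \<open>inner\<close> has
      rewritten the inner products.\<close>
    by (simp add: emp_AA_def dsum_scale_def dsum_sum_def inner) (simp add: poly_feature_def)
  have AY: "emp_AY N X Y = (1 / real N * (\<Sum>i=1..N. Y i),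
      \<lambda>l s. 1 / real N * (\<Sum>i=1..N. Y i * (\<Prod>j=1..l. X i (s j))))"
    by (simp add: emp_AY_def dsum_scale_def dsum_sum_def poly_feature_def)
  have "lam * b0 + 1 / real N * (\<Sum>i=1..N. b0 + S i) = 1 / real N * (\<Sum>i=1..N. Y i)"
    using eq0 assms(2) unfolding S_def[symmetric] by (simp add: sum.distrib field_simps)
  \<comment> \<open>\<open>P i\<close> stands for the value of the \<open>l\<close>-th tensor power
    of \<open>X i\<close> at a point, so the equation in degree \<open>l\<close> holds everywhere on
    the cube, hence almost everywhere.\<close>
  moreover have "lam * (\<Sum>i=1..N. b l i * P i) + 1 / real N * (\<Sum>i=1..N. (b0 + S i) * P i)
      = 1 / real N * (\<Sum>i=1..N. Y i * P i)" if l: "l \<in> {1..p}" for l and P :: "nat \<Rightarrow> real"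
  proof -
    have "lam * (\<Sum>i=1..N. b l i * P i) + 1 / real N * (\<Sum>i=1..N. (b0 + S i) * P i)
        = (\<Sum>i=1..N. (lam * b l i + 1 / real N * b0 + 1 / real N * S i) * P i)"
      unfolding sum_distrib_left sum.distrib[symmetric] by (intro sum.cong) (simp_all add: algebra_simps)
    also have "\<dots> = (\<Sum>i=1..N. (1 / real N * Y i) * P i)"
      unfolding S_def using eqk[OF l] by (intro sum.cong) auto
    finally show ?thesis
      by (simp add: sum_distrib_left mult.assoc)
  qed
  ultimately have "dsum_eq I p (dsum_add (dsum_scale lam u) (emp_AA I p N X u)) (emp_AY N X Y)"
    \<comment> \<open>\<open>AA\<close> speaks of \<open>u\<close> as a whole and has to be applied
      before \<open>u\<close> is expanded.\<close>
    unfolding AA AY unfolding u by (simp add: dsum_eq_def dsum_add_def dsum_scale_def)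
  with in_L2 same total show ?thesis
    by blast
qed

end
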